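(* Let $\mathcal{B}_0$ be the set consisting of the following eleven rules: the Transitivity Rule, the Universal Rule, the Meta-Universal Rule, the Conjunction Rule, the Meta-Conjunction Rule, the Disjunction Introduction Rule, the Disjunction Elimination Rule, the Meta-Disjunction Rule, the Elimination of Case Rule, the Double Negation Rule, and the Strong De Morgan Rule. Then $\mathcal{B}_0$ is a stable base.
   Context: Framework. Algorithms are recursive algorithms in a fixed standard model. A datum is anything that can be input to an algorithm; data include natural numbers and algorithms, and every finite list of data is a datum. Every algorithm accepts exactly one input datum and either does not halt or halts with exactly one output datum. Every datum has a positive integer size, only finitely many data have a given size, and the size of a list is strictly greater than the sum of the sizes of its items. A process is a pair (algorithm, input). Every halting process has a positive integer runtime; if a process runs subprocesses in its execution, its runtime is strictly greater than the sum of the runtimes of the halting subprocesses. An algorithmic statement is a datum $[\alpha,u,v]$ with $\alpha$ an algorithm, asserting that $\alpha$ with input $u$ halts with output $v$; it is true if this is so and false otherwise, and it is directly false if $\alpha$ halts on $u$ with an output different from $v$. The process associated with $[\alpha,u,v]$ is $\alpha$ run with input $u$. To assert (or say "holds" of) an algorithmic statement is to say that it is true. Rules and libraries. An algorithmic sequence is an algorithm $\rho$ that halts on every positive integer $n$; its output is written $\rho_n$. A rule is an algorithm which, on every input $[H,\rho,m]$ with $H$ a finite list of algorithmic statements (hypothesis list), $\rho$ an algorithmic sequence (nominal library) and $m$ a positive integer (resource integer), halts and outputs a list of algorithmic statements (conclusion list) having $H$ as an initial sublist, and which is monotone: if $m'\ge m$ and every item of $H$ is an item of $H'$, then every item of the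 output on $[H,\rho,m]$ is an item of the output on $[H',\rho,m']$. A library is an algorithmic sequence $\rho$ such that every $\rho_n$ is a rule (not necessarily distinct); the $\rho_n$ are the rules contained in $\rho$. A rule is $\rho$-valid if for every list $H$ of true statements and every $m$, its output on $[H,\rho,m]$ consists only of true statements. A library $\rho$ is valid if all its rules are $\rho$-valid. Bases. A base is a set $\mathcal{B}$ of rules that is finite or is the set of terms of a library. A $\mathcal{B}$-library is a library containing all rules of $\mathcal{B}$. A $\mathcal{B}$-library $\rho$ is valid outside $\mathcal{B}$ if every rule in $\rho$ which is not in $\mathcal{B}$ is $\rho$-valid. A base $\mathcal{B}$ is stable if every $\mathcal{B}$-library that is valid outside $\mathcal{B}$ is valid. Deduction. Fix a recursive bijection $f:\mathbb{N}_+\to\mathbb{N}_+\times\mathbb{N}_+$. The algorithm $\mathrm{deduce}$, on input $[\Gamma,\rho,B]$ ($\Gamma$ a list of algorithmic statements, $\rho$ a library, $B$ an algorithmic statement), computes lists $H_0=\Gamma,H_1,H_2,\dots$, where for $i>0$ with $f(i)=(k,m)$ the list $H_i$ is the output of $\rho_k$, run as a subprocess on $[H_{i-1},\rho,m]$; after computing each $H_i$ it checks whether $B$ is on $H_i$, outputs $1$ if so, and otherwise continues. The algorithmic statement $[\mathrm{deduce},[\Gamma,\rho,B],1]$ is denoted $\Gamma\vdash_\rho B$ (the notation is used for any datum $\rho$). $A\Rightarrow_\rho B$ denotes $[A]\vdash_\rho B$. Connectives. The algorithm $\mathrm{and}$ on input $[A,B]$ outputs $1$ if both algorithmic statements $A,B$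 are true, $0$ if either is directly false, and otherwise does not halt; $A\wedge B$ denotes $[\mathrm{and},[A,B],1]$. The algorithm $\mathrm{or}$ on $[A,B]$ outputs $1$ if $A$ or $B$ is true, $0$ if both are directly false, and otherwise does not halt; $A\vee B$ denotes $[\mathrm{or},[A,B],1]$. The algorithm $\mathrm{sneg}$ on input $[\alpha,u,v]$ runs $\alpha$ on $u$, outputs $0$ if it halts with output $v$, $1$ if it halts with another output, and otherwise does not halt; $-A$ denotes $[\mathrm{sneg},A,1]$. Rule diagrams. A rule implementing "$X_1,\dots,X_r\,/\,Y$" is the algorithm which on input $[H,\rho,m]$ outputs $H$ with $Y$ appended for every instance (letters $A,B,C,G$ ranging over algorithmic statements) whose premises $X_1,\dots,X_r$ are all on $H$; the $\rho$ in $\Rightarrow_\rho$ is the nominal library in the input. Several diagrams can be implemented simultaneously by one rule. The rules. Transitivity: $A\Rightarrow_\rho B,\ B\Rightarrow_\rho C\,/\,A\Rightarrow_\rho C$. Universal: on $[H,\rho,m]$ appends to $H$ all $m$-true algorithmic statements, where $B$ is $m$-true if the datum $B$ has size at most $m$, the runtime of its associated process is at most $m$, and $B$ is true. Meta-Universal: $B\,/\,A\Rightarrow_\rho B$, restricted to those conclusions $A\Rightarrow_\rho B$ of size at most $m$. Conjunction: simultaneously $A,B\,/\,A\wedge B$; $A\wedge B\,/\,A$; $A\wedge B\,/\,B$. Meta-Conjunction: $A\Rightarrow_\rho B,\ A\Rightarrow_\rho C\,/\,A\Rightarrow_\rho(B\wedge C)$. Disjunction Introduction: simultaneously $A\,/\,A\vee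 B$ and $B\,/\,A\vee B$, restricted to conclusions $A\vee B$ of size at most $m$. Disjunction Elimination: whenever statements of the forms $G\wedge A\Rightarrow_\rho C$, $G\wedge B\Rightarrow_\rho C$, $G$, $A\vee B$ are all on $H$, the rule runs (as subprocesses) the processes associated with the first two to determine whether their runtimes are less than $m$; if both runtimes are less than $m$ and both of these statements are true, it appends $C$. Meta-Disjunction: $G\wedge A\Rightarrow_\rho C,\ G\wedge B\Rightarrow_\rho C\,/\,G\wedge(A\vee B)\Rightarrow_\rho C$. Elimination of Case: $A\vee B,\ -A\,/\,B$. Double Negation: simultaneously $A\,/\,{-}{-}A$ and ${-}{-}A\,/\,A$. Strong De Morgan: simultaneously $-(A\vee B)\,/\,{-A}\wedge{-B}$; $-A\wedge -B\,/\,{-(A\vee B)}$; $-(A\wedge B)\,/\,{-A}\vee{-B}$; $-A\vee -B\,/\,{-(A\wedge B)}$. *)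

theory Defs
  imports "HOL-Library.Multiset"
begin

section \<open>Models of computation\<close>

text \<open>
  The paper works over a standard model of recursive algorithms of which it uses only the
  interface below; everything here is relative to an arbitrary model \<open>M\<close> with that interface.
  Naturals and lists of data are embedded into the type of data; \<open>outp M \<alpha> u\<close> is \<open>None\<close> iff
  \<open>\<alpha>\<close> does not halt on \<open>u\<close>.  \<open>runtime\<close> and \<open>subprocs\<close> are meaningful for halting processes only.
  \<open>subprocs M \<alpha> u\<close> contains the subprocesses run in the execution of \<open>\<alpha>\<close> on \<open>u\<close>,
  with multiplicity.
\<close>

record 'd comp_model =
  nat_dat :: "nat \<Rightarrow> 'd"
  list_dat :: "'d list \<Rightarrow> 'd"
  algos :: "'d set"
  dsize :: "'d \<Rightarrow> nat"
  outp :: "'d \<Rightarrow> 'd \<Rightarrow> 'd option"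
  runtime :: "'d \<Rightarrow> 'd \<Rightarrow> nat"
  subprocs :: "'d \<Rightarrow> 'd \<Rightarrow> ('d \<times> 'd) multiset"

definition halts :: "('d, 'x) comp_model_scheme \<Rightarrow> 'd \<Rightarrow> 'd \<Rightarrow> bool" where
  "halts M \<alpha> u \<longleftrightarrow> outp M \<alpha> u \<noteq> None"

locale computation_model =
  fixes M :: "('d, 'x) comp_model_scheme"
  assumes inj_nat_dat: "inj (nat_dat M)"
    and inj_list_dat: "inj (list_dat M)"
    and dsize_pos: "dsize M d > 0"
    and finite_dsize: "finite {d. dsize M d = n}"
    and dsize_list: "dsize M (list_dat M ds) > (\<Sum>d\<leftarrow>ds. dsize M d)"
    and runtime_pos: "\<alpha> \<in> algos M \<Longrightarrow> halts M \<alpha> u \<Longrightarrow> runtime M \<alpha> u > 0"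
    and subprocs_algos: "\<alpha> \<in> algos M \<Longrightarrow> (\<beta>, w) \<in># subprocs M \<alpha> u \<Longrightarrow> \<beta> \<in> algos M"
    and runtime_subprocs: "\<alpha> \<in> algos M \<Longrightarrow> halts M \<alpha> u \<Longrightarrow>
      runtime M \<alpha> u >
        (\<Sum>(\<beta>, w) \<in># filter_mset (\<lambda>(\<beta>, w). halts M \<beta> w) (subprocs M \<alpha> u). runtime M \<beta> w)"


section \<open>Algorithmic statements\<close>

definition stmt :: "('d, 'x) comp_model_scheme \<Rightarrow> 'd \<Rightarrow> 'd \<Rightarrow> 'd \<Rightarrow> 'd" where
  "stmt M \<alpha> u v = list_dat M [\<alpha>, u, v]"

definition stmts :: "('d, 'x) comp_model_scheme \<Rightarrow> 'd set" where
  "stmts M = {stmt M \<alpha> u v | \<alpha> u v. \<alpha> \<in> algos M}"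

definition true_stmts :: "('d, 'x) comp_model_scheme \<Rightarrow> 'd set" where
  "true_stmts M = {stmt M \<alpha> u v | \<alpha> u v. \<alpha> \<in> algos M \<and> outp M \<alpha> u = Some v}"

definition directly_false_stmts :: "('d, 'x) comp_model_scheme \<Rightarrow> 'd set" where
  "directly_false_stmts M =
    {stmt M \<alpha> u v | \<alpha> u v. \<alpha> \<in> algos M \<and> (\<exists>v'. outp M \<alpha> u = Some v' \<and> v' \<noteq> v)}"

definition m_true_stmts :: "('d, 'x) comp_model_scheme \<Rightarrow> nat \<Rightarrow> 'd set" where
  "m_true_stmts M m =
    {stmt M \<alpha> u v | \<alpha> u v. \<alpha> \<in> algos M \<and> outp M \<alpha> u = Some v \<and> runtime M \<alpha> u \<le> m \<and>
       dsize M (stmt M \<alpha> u v) \<le> m}"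


section \<open>Rules and libraries\<close>

definition algorithmic_sequence :: "('d, 'x) comp_model_scheme \<Rightarrow> 'd \<Rightarrow> bool" where
  "algorithmic_sequence M \<rho> \<longleftrightarrow> \<rho> \<in> algos M \<and> (\<forall>n\<ge>1. halts M \<rho> (nat_dat M n))"

definition seq_term :: "('d, 'x) comp_model_scheme \<Rightarrow> 'd \<Rightarrow> nat \<Rightarrow> 'd" where
  "seq_term M \<rho> n = the (outp M \<rho> (nat_dat M n))"

definition rule_input :: "('d, 'x) comp_model_scheme \<Rightarrow> 'd list \<Rightarrow> 'd \<Rightarrow> nat \<Rightarrow> 'd" where
  "rule_input M H \<rho> m = list_dat M [list_dat M H, \<rho>, nat_dat M m]"

definition admissible :: "('d, 'x) comp_model_scheme \<Rightarrow> 'd list \<Rightarrow> 'd \<Rightarrow> nat \<Rightarrow> bool" where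
  "admissible M H \<rho> m \<longleftrightarrow> set H \<subseteq> stmts M \<and> algorithmic_sequence M \<rho> \<and> m \<ge> 1"

definition concludes ::
    "('d, 'x) comp_model_scheme \<Rightarrow> 'd \<Rightarrow> 'd list \<Rightarrow> 'd \<Rightarrow> nat \<Rightarrow> 'd list \<Rightarrow> bool" where
  "concludes M R H \<rho> m K \<longleftrightarrow> outp M R (rule_input M H \<rho> m) = Some (list_dat M K)"

definition is_rule :: "('d, 'x) comp_model_scheme \<Rightarrow> 'd \<Rightarrow> bool" where
  "is_rule M R \<longleftrightarrow> R \<in> algos M \<and>
    (\<forall>H \<rho> m. admissible M H \<rho> m \<longrightarrow>
       (\<exists>L. set L \<subseteq> stmts M \<and> concludes M R H \<rho> m (H @ L))) \<and>
    (\<forall>H H' \<rho> m m' K K'.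
       admissible M H \<rho> m \<and> admissible M H' \<rho> m' \<and> m \<le> m' \<and> set H \<subseteq> set H' \<and>
       concludes M R H \<rho> m K \<and> concludes M R H' \<rho> m' K' \<longrightarrow> set K \<subseteq> set K')"

definition is_library :: "('d, 'x) comp_model_scheme \<Rightarrow> 'd \<Rightarrow> bool" where
  "is_library M \<rho> \<longleftrightarrow> algorithmic_sequence M \<rho> \<and> (\<forall>n\<ge>1. is_rule M (seq_term M \<rho> n))"

definition rules_of :: "('d, 'x) comp_model_scheme \<Rightarrow> 'd \<Rightarrow> 'd set" where
  "rules_of M \<rho> = seq_term M \<rho> ` {1..}"

definition rule_valid :: "('d, 'x) comp_model_scheme \<Rightarrow> 'd \<Rightarrow> 'd \<Rightarrow> bool" where
  "rule_valid M \<rho> R \<longleftrightarrow>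
    (\<forall>H m K. set H \<subseteq> true_stmts M \<and> m \<ge> 1 \<and> concludes M R H \<rho> m K \<longrightarrow> set K \<subseteq> true_stmts M)"

definition library_valid :: "('d, 'x) comp_model_scheme \<Rightarrow> 'd \<Rightarrow> bool" where
  "library_valid M \<rho> \<longleftrightarrow> (\<forall>R \<in> rules_of M \<rho>. rule_valid M \<rho> R)"


section \<open>Bases\<close>

definition is_base :: "('d, 'x) comp_model_scheme \<Rightarrow> 'd set \<Rightarrow> bool" where
  "is_base M \<B> \<longleftrightarrow> (\<forall>R \<in> \<B>. is_rule M R) \<and>
    (finite \<B> \<or> (\<exists>\<rho>. is_library M \<rho> \<and> \<B> = rules_of M \<rho>))"

definition base_library :: "('d, 'x) comp_model_scheme \<Rightarrow> 'd set \<Rightarrow> 'd \<Rightarrow> bool" where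
  "base_library M \<B> \<rho> \<longleftrightarrow> is_library M \<rho> \<and> \<B> \<subseteq> rules_of M \<rho>"

definition valid_outside :: "('d, 'x) comp_model_scheme \<Rightarrow> 'd set \<Rightarrow> 'd \<Rightarrow> bool" where
  "valid_outside M \<B> \<rho> \<longleftrightarrow> (\<forall>R \<in> rules_of M \<rho> - \<B>. rule_valid M \<rho> R)"

definition is_stable_base :: "('d, 'x) comp_model_scheme \<Rightarrow> 'd set \<Rightarrow> bool" where
  "is_stable_base M \<B> \<longleftrightarrow> is_base M \<B> \<and>
    (\<forall>\<rho>. base_library M \<B> \<rho> \<and> valid_outside M \<B> \<rho> \<longrightarrow> library_valid M \<rho>)"


section \<open>Deduction and connectives\<close>

text \<open>
  The extended record carries the fixed bijection \<open>f\<close> (on positive integers; values at 0 are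
  irrelevant) and the algorithms deduce, and, or, sneg.
\<close>

record 'd deduction_model = "'d comp_model" +
  enum_pairs :: "nat \<Rightarrow> nat \<times> nat"
  deduce_alg :: 'd
  and_alg :: 'd
  or_alg :: 'd
  sneg_alg :: 'd

definition ded_input :: "('d, 'x) deduction_model_scheme \<Rightarrow> 'd list \<Rightarrow> 'd \<Rightarrow> 'd \<Rightarrow> 'd" where
  "ded_input M \<Gamma> \<rho> B = list_dat M [list_dat M \<Gamma>, \<rho>, B]"

definition deducible :: "('d, 'x) deduction_model_scheme \<Rightarrow> 'd list \<Rightarrow> 'd \<Rightarrow> 'd \<Rightarrow> 'd" where
  "deducible M \<Gamma> \<rho> B = stmt M (deduce_alg M) (ded_input M \<Gamma> \<rho> B) (nat_dat M 1)"

definition imp :: "('d, 'x) deduction_model_scheme \<Rightarrow> 'd \<Rightarrow> 'd \<Rightarrow> 'd \<Rightarrow> 'd" where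
  "imp M \<rho> A B = deducible M [A] \<rho> B"

definition conj_st :: "('d, 'x) deduction_model_scheme \<Rightarrow> 'd \<Rightarrow> 'd \<Rightarrow> 'd" where
  "conj_st M A B = stmt M (and_alg M) (list_dat M [A, B]) (nat_dat M 1)"

definition disj_st :: "('d, 'x) deduction_model_scheme \<Rightarrow> 'd \<Rightarrow> 'd \<Rightarrow> 'd" where
  "disj_st M A B = stmt M (or_alg M) (list_dat M [A, B]) (nat_dat M 1)"

definition neg_st :: "('d, 'x) deduction_model_scheme \<Rightarrow> 'd \<Rightarrow> 'd" where
  "neg_st M A = stmt M (sneg_alg M) A (nat_dat M 1)"

primrec ded_list :: "('d, 'x) deduction_model_scheme \<Rightarrow> 'd list \<Rightarrow> 'd \<Rightarrow> nat \<Rightarrow> 'd list" where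
  "ded_list M \<Gamma> \<rho> 0 = \<Gamma>"
| "ded_list M \<Gamma> \<rho> (Suc i) =
    (let (k, m) = enum_pairs M (Suc i)
     in THE K. concludes M (seq_term M \<rho> k) (ded_list M \<Gamma> \<rho> i) \<rho> m K)"

text \<open>The process computing \<open>H\<^sub>i\<close> from \<open>H\<^sub>i\<^sub>-\<^sub>1\<close>, for \<open>i \<ge> 1\<close>.\<close>

definition ded_step ::
    "('d, 'x) deduction_model_scheme \<Rightarrow> 'd list \<Rightarrow> 'd \<Rightarrow> nat \<Rightarrow> 'd \<times> 'd" where
  "ded_step M \<Gamma> \<rho> i =
    (let (k, m) = enum_pairs M i
     in (seq_term M \<rho> k, rule_input M (ded_list M \<Gamma> \<rho> (i - 1)) \<rho> m))"

text \<open>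
  The behaviour of the four algorithms on inputs not covered below is left open.
  A nominal library that is not a library may occur in a statement \<open>imp M \<rho> A B\<close>;
  nothing is assumed about deduce there.
\<close>

locale deduction_framework = computation_model M
  for M :: "('d, 'x) deduction_model_scheme" +
  assumes enum_bij: "bij_betw (enum_pairs M) {1..} ({1..} \<times> {1..})"
    and enum_recursive: "\<exists>\<phi> \<in> algos M. \<forall>i\<ge>1.
      outp M \<phi> (nat_dat M i) =
        Some (list_dat M [nat_dat M (fst (enum_pairs M i)), nat_dat M (snd (enum_pairs M i))])"
    and deduce_algo: "deduce_alg M \<in> algos M"
    and deduce_outp: "set \<Gamma> \<subseteq> stmts M \<Longrightarrow> is_library M \<rho> \<Longrightarrow> B \<in> stmts M \<Longrightarrow>
      outp M (deduce_alg M) (ded_input M \<Gamma> \<rho> B) =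
        (if \<exists>i. B \<in> set (ded_list M \<Gamma> \<rho> i) then Some (nat_dat M 1) else None)"
    and deduce_subprocs: "set \<Gamma> \<subseteq> stmts M \<Longrightarrow> is_library M \<rho> \<Longrightarrow> B \<in> stmts M \<Longrightarrow>
      \<exists>i. B \<in> set (ded_list M \<Gamma> \<rho> i) \<Longrightarrow>
      image_mset (ded_step M \<Gamma> \<rho>) (mset_set {1..LEAST i. B \<in> set (ded_list M \<Gamma> \<rho> i)})
        \<subseteq># subprocs M (deduce_alg M) (ded_input M \<Gamma> \<rho> B)"
    and and_algo: "and_alg M \<in> algos M"
    and and_outp: "A \<in> stmts M \<Longrightarrow> B \<in> stmts M \<Longrightarrow>
      outp M (and_alg M) (list_dat M [A, B]) =
        (if A \<in> true_stmts M \<and> B \<in> true_stmts M then Some (nat_dat M 1)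
         else if A \<in> directly_false_stmts M \<or> B \<in> directly_false_stmts M then Some (nat_dat M 0)
         else None)"
    and or_algo: "or_alg M \<in> algos M"
    and or_outp: "A \<in> stmts M \<Longrightarrow> B \<in> stmts M \<Longrightarrow>
      outp M (or_alg M) (list_dat M [A, B]) =
        (if A \<in> true_stmts M \<or> B \<in> true_stmts M then Some (nat_dat M 1)
         else if A \<in> directly_false_stmts M \<and> B \<in> directly_false_stmts M then Some (nat_dat M 0)
         else None)"
    and sneg_algo: "sneg_alg M \<in> algos M"
    and sneg_outp: "\<alpha> \<in> algos M \<Longrightarrow>
      outp M (sneg_alg M) (stmt M \<alpha> u v) =
        (case outp M \<alpha> u of None \<Rightarrow> None
         | Some v' \<Rightarrow> Some (nat_dat M (if v' = v then 0 else 1)))"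


section \<open>The rules\<close>

text \<open>
  \<open>R\<close> outputs \<open>H\<close> followed by an enumeration, in any order and possibly with repetitions,
  of the set \<open>Y H \<rho> m\<close> of conclusions of all instances of the diagram.
\<close>

definition implements ::
    "('d, 'x) comp_model_scheme \<Rightarrow> 'd \<Rightarrow> ('d list \<Rightarrow> 'd \<Rightarrow> nat \<Rightarrow> 'd set) \<Rightarrow> bool" where
  "implements M R Y \<longleftrightarrow> R \<in> algos M \<and>
    (\<forall>H \<rho> m. admissible M H \<rho> m \<longrightarrow> (\<exists>L. set L = Y H \<rho> m \<and> concludes M R H \<rho> m (H @ L)))"

definition transitivity_rule :: "('d, 'x) deduction_model_scheme \<Rightarrow> 'd \<Rightarrow> bool" where
  "transitivity_rule M R \<longleftrightarrow> implements M R (\<lambda>H \<rho> m.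
    {imp M \<rho> A C | A B C. A \<in> stmts M \<and> B \<in> stmts M \<and> C \<in> stmts M \<and>
       imp M \<rho> A B \<in> set H \<and> imp M \<rho> B C \<in> set H})"

definition universal_rule :: "('d, 'x) deduction_model_scheme \<Rightarrow> 'd \<Rightarrow> bool" where
  "universal_rule M R \<longleftrightarrow> implements M R (\<lambda>H \<rho> m. m_true_stmts M m)"

definition meta_universal_rule :: "('d, 'x) deduction_model_scheme \<Rightarrow> 'd \<Rightarrow> bool" where
  "meta_universal_rule M R \<longleftrightarrow> implements M R (\<lambda>H \<rho> m.
    {imp M \<rho> A B | A B. A \<in> stmts M \<and> B \<in> stmts M \<and> B \<in> set H \<and> dsize M (imp M \<rho> A B) \<le> m})"

definition conjunction_rule :: "('d, 'x) deduction_model_scheme \<Rightarrow> 'd \<Rightarrow> bool" where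
  "conjunction_rule M R \<longleftrightarrow> implements M R (\<lambda>H \<rho> m.
    {conj_st M A B | A B. A \<in> stmts M \<and> B \<in> stmts M \<and> A \<in> set H \<and> B \<in> set H} \<union>
    {A | A B. A \<in> stmts M \<and> B \<in> stmts M \<and> conj_st M A B \<in> set H} \<union>
    {B | A B. A \<in> stmts M \<and> B \<in> stmts M \<and> conj_st M A B \<in> set H})"

definition meta_conjunction_rule :: "('d, 'x) deduction_model_scheme \<Rightarrow> 'd \<Rightarrow> bool" where
  "meta_conjunction_rule M R \<longleftrightarrow> implements M R (\<lambda>H \<rho> m.
    {imp M \<rho> A (conj_st M B C) | A B C. A \<in> stmts M \<and> B \<in> stmts M \<and> C \<in> stmts M \<and>
       imp M \<rho> A B \<in> set H \<and> imp M \<rho> A C \<in> set H})"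

definition disjunction_introduction_rule :: "('d, 'x) deduction_model_scheme \<Rightarrow> 'd \<Rightarrow> bool" where
  "disjunction_introduction_rule M R \<longleftrightarrow> implements M R (\<lambda>H \<rho> m.
    {disj_st M A B | A B. A \<in> stmts M \<and> B \<in> stmts M \<and> A \<in> set H \<and> dsize M (disj_st M A B) \<le> m} \<union>
    {disj_st M A B | A B. A \<in> stmts M \<and> B \<in> stmts M \<and> B \<in> set H \<and> dsize M (disj_st M A B) \<le> m})"

definition disj_elim_match ::
    "('d, 'x) deduction_model_scheme \<Rightarrow> 'd list \<Rightarrow> 'd \<Rightarrow> 'd \<Rightarrow> 'd \<Rightarrow> 'd \<Rightarrow> 'd \<Rightarrow> bool" where
  "disj_elim_match M H \<rho> G A B C \<longleftrightarrow>
    G \<in> stmts M \<and> A \<in> stmts M \<and> B \<in> stmts M \<and> C \<in> stmts M \<and>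
    imp M \<rho> (conj_st M G A) C \<in> set H \<and> imp M \<rho> (conj_st M G B) C \<in> set H \<and>
    G \<in> set H \<and> disj_st M A B \<in> set H"

text \<open>The process associated with \<open>imp M \<rho> A B\<close> halts with runtime less than \<open>m\<close>.\<close>

definition imp_halts_below ::
    "('d, 'x) deduction_model_scheme \<Rightarrow> 'd \<Rightarrow> 'd \<Rightarrow> 'd \<Rightarrow> nat \<Rightarrow> bool" where
  "imp_halts_below M \<rho> A B m \<longleftrightarrow>
    halts M (deduce_alg M) (ded_input M [A] \<rho> B) \<and>
    runtime M (deduce_alg M) (ded_input M [A] \<rho> B) < m"

text \<open>
  A process that has not halted within the time bound is abandoned by the rule; only the ones
  that halt with runtime less than \<open>m\<close> are required to be among the rule's subprocesses.
\<close>

definition disjunction_elimination_rule :: "('d, 'x) deduction_model_scheme \<Rightarrow> 'd \<Rightarrow> bool" where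
  "disjunction_elimination_rule M R \<longleftrightarrow>
    implements M R (\<lambda>H \<rho> m.
      {C | G A B C. disj_elim_match M H \<rho> G A B C \<and>
         imp_halts_below M \<rho> (conj_st M G A) C m \<and> imp_halts_below M \<rho> (conj_st M G B) C m \<and>
         imp M \<rho> (conj_st M G A) C \<in> true_stmts M \<and>
         imp M \<rho> (conj_st M G B) C \<in> true_stmts M}) \<and>
    (\<forall>H \<rho> m G A B C. admissible M H \<rho> m \<and> disj_elim_match M H \<rho> G A B C \<longrightarrow>
       (\<forall>D \<in> {A, B}. imp_halts_below M \<rho> (conj_st M G D) C m \<longrightarrow>
          (deduce_alg M, ded_input M [conj_st M G D] \<rho> C)
            \<in># subprocs M R (rule_input M H \<rho> m)))"

definition meta_disjunction_rule :: "('d, 'x) deduction_model_scheme \<Rightarrow> 'd \<Rightarrow> bool" where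
  "meta_disjunction_rule M R \<longleftrightarrow> implements M R (\<lambda>H \<rho> m.
    {imp M \<rho> (conj_st M G (disj_st M A B)) C | G A B C.
       G \<in> stmts M \<and> A \<in> stmts M \<and> B \<in> stmts M \<and> C \<in> stmts M \<and>
       imp M \<rho> (conj_st M G A) C \<in> set H \<and> imp M \<rho> (conj_st M G B) C \<in> set H})"

definition elimination_of_case_rule :: "('d, 'x) deduction_model_scheme \<Rightarrow> 'd \<Rightarrow> bool" where
  "elimination_of_case_rule M R \<longleftrightarrow> implements M R (\<lambda>H \<rho> m.
    {B | A B. A \<in> stmts M \<and> B \<in> stmts M \<and> disj_st M A B \<in> set H \<and> neg_st M A \<in> set H})"

definition double_negation_rule :: "('d, 'x) deduction_model_scheme \<Rightarrow> 'd \<Rightarrow> bool" where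
  "double_negation_rule M R \<longleftrightarrow> implements M R (\<lambda>H \<rho> m.
    {neg_st M (neg_st M A) | A. A \<in> stmts M \<and> A \<in> set H} \<union>
    {A. A \<in> stmts M \<and> neg_st M (neg_st M A) \<in> set H})"

definition strong_de_morgan_rule :: "('d, 'x) deduction_model_scheme \<Rightarrow> 'd \<Rightarrow> bool" where
  "strong_de_morgan_rule M R \<longleftrightarrow> implements M R (\<lambda>H \<rho> m.
    {conj_st M (neg_st M A) (neg_st M B) | A B.
       A \<in> stmts M \<and> B \<in> stmts M \<and> neg_st M (disj_st M A B) \<in> set H} \<union>
    {neg_st M (disj_st M A B) | A B.
       A \<in> stmts M \<and> B \<in> stmts M \<and> conj_st M (neg_st M A) (neg_st M B) \<in> set H} \<union>
    {disj_st M (neg_st M A) (neg_st M B) | A B.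
       A \<in> stmts M \<and> B \<in> stmts M \<and> neg_st M (conj_st M A B) \<in> set H} \<union>
    {neg_st M (conj_st M A B) | A B.
       A \<in> stmts M \<and> B \<in> stmts M \<and> disj_st M (neg_st M A) (neg_st M B) \<in> set H})"

end

theory Submission
  imports Defs
begin

text \<open>
  Since every rule is monotone and occurs in the enumeration with arbitrarily large resources, the
  statements derivable from a list are closed under all rules of the library.  This
  completeness makes the meta rules valid: the Universal Rule supplies every true statement
  inside a deduction.  The one rule whose validity needs soundness of deduction is Disjunction
  Elimination.  It only trusts deductions that it has run as subprocesses, and a deduction
  applying this rule runs the rule as a subprocess, so soundness follows by induction on the
  runtime of the deduction.
\<close>

section \<open>Statements, rules and runtimes in a model of computation\<close>

context computation_model
begin

lemma stmt_eq_iff [simp]: "stmt M \<alpha> u v = stmt M \<beta> u' v' \<longleftrightarrow> \<alpha> = \<beta> \<and> u = u' \<and> v = v'"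
  unfolding stmt_def by (auto dest: injD[OF inj_list_dat])

lemma nat_dat_eq_iff [simp]: "nat_dat M i = nat_dat M j \<longleftrightarrow> i = j"
  by (auto dest: injD[OF inj_nat_dat])

lemma stmt_in_stmts [simp]: "stmt M \<alpha> u v \<in> stmts M \<longleftrightarrow> \<alpha> \<in> algos M"
  unfolding stmts_def by auto

lemma stmt_in_true_stmts:
  "stmt M \<alpha> u v \<in> true_stmts M \<longleftrightarrow> \<alpha> \<in> algos M \<and> outp M \<alpha> u = Some v"
  unfolding true_stmts_def by auto

lemma stmt_in_directly_false_stmts:
  "stmt M \<alpha> u v \<in> directly_false_stmts M \<longleftrightarrow>
    \<alpha> \<in> algos M \<and> (\<exists>v'. outp M \<alpha> u = Some v' \<and> v' \<noteq> v)"
  unfolding directly_false_stmts_def by auto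

lemma true_stmts_subset: "true_stmts M \<subseteq> stmts M"
  unfolding true_stmts_def by auto

lemma m_true_stmts_subset: "m_true_stmts M m \<subseteq> true_stmts M"
  unfolding m_true_stmts_def true_stmts_def by blast

lemma true_stmt_m_true:
  assumes "B \<in> true_stmts M"
  obtains m where "m \<ge> 1" "B \<in> m_true_stmts M m"
proof -
  obtain \<alpha> u v where B: "B = stmt M \<alpha> u v" "\<alpha> \<in> algos M" "outp M \<alpha> u = Some v"
    using assms unfolding true_stmts_def by blast
  show thesis
  proof (rule that)
    \<comment> \<open>One number has to bound both the runtime and the size; the 1 makes it a legal
      resource integer.\<close>
    show "B \<in> m_true_stmts M (max 1 (max (runtime M \<alpha> u) (dsize M B)))"
      unfolding m_true_stmts_def using B by fastforce
  qed simp
qed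

lemma true_not_directly_false: "A \<in> true_stmts M \<Longrightarrow> A \<notin> directly_false_stmts M"
  unfolding true_stmts_def directly_false_stmts_def by auto

lemma concludes_unique: "concludes M R H \<rho> m K \<Longrightarrow> concludes M R H \<rho> m K' \<Longrightarrow> K = K'"
  unfolding concludes_def by (auto dest: injD[OF inj_list_dat])

lemma implements_set:
  assumes "implements M R Y" "admissible M H \<rho> m" "concludes M R H \<rho> m K"
  shows "set K = set H \<union> Y H \<rho> m"
proof -
  obtain L where "set L = Y H \<rho> m" "concludes M R H \<rho> m (H @ L)"
    using assms(1,2) unfolding implements_def by blast
  then show ?thesis
    using concludes_unique[OF assms(3)] by auto
qed

text \<open>The order and repetitions in an output list are left open, but the output itself is
  unique. By \<open>implements_set\<close>, everything a rule must satisfy then becomes a fact about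
  the set \<open>Y\<close>.\<close>

lemma implements_is_rule:
  assumes "implements M R Y"
    and "\<And>H \<rho> m. admissible M H \<rho> m \<Longrightarrow> Y H \<rho> m \<subseteq> stmts M"
    and "\<And>H H' \<rho> m m'. set H \<subseteq> set H' \<Longrightarrow> m \<le> m' \<Longrightarrow> Y H \<rho> m \<subseteq> Y H' \<rho> m'"
  shows "is_rule M R"
  unfolding is_rule_def
proof (intro conjI allI impI)
  show "R \<in> algos M"
    using assms(1) unfolding implements_def by blast
next
  fix H \<rho> m
  assume "admissible M H \<rho> m"
  then show "\<exists>L. set L \<subseteq> stmts M \<and> concludes M R H \<rho> m (H @ L)"
    using assms(1,2) unfolding implements_def by metis
next
  fix H H' \<rho> m m' K K'
  assume a: "admissible M H \<rho> m \<and> admissible M H' \<rho> m' \<and> m \<le> m' \<and> set H \<subseteq> set H' \<and>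
    concludes M R H \<rho> m K \<and> concludes M R H' \<rho> m' K'"
  then have "set K = set H \<union> Y H \<rho> m" "set K' = set H' \<union> Y H' \<rho> m'"
    using implements_set[OF assms(1)] by blast+
  then show "set K \<subseteq> set K'"
    using a assms(3)[of H H' m m' \<rho>] by blast
qed

lemma implements_rule_valid:
  assumes "implements M R Y" "algorithmic_sequence M \<rho>"
    and "\<And>H m. set H \<subseteq> true_stmts M \<Longrightarrow> Y H \<rho> m \<subseteq> true_stmts M"
  shows "rule_valid M \<rho> R"
  unfolding rule_valid_def
proof (intro allI impI)
  fix H m K
  assume a: "set H \<subseteq> true_stmts M \<and> 1 \<le> m \<and> concludes M R H \<rho> m K"
  then have "admissible M H \<rho> m"
    using assms(2) true_stmts_subset unfolding admissible_def by blast
  then have "set K = set H \<union> Y H \<rho> m"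
    using implements_set[OF assms(1)] a by blast
  then show "set K \<subseteq> true_stmts M"
    using a assms(3)[of H m] by blast
qed

lemma library_concludes:
  assumes "is_library M \<rho>" "k \<ge> 1" "set H \<subseteq> stmts M" "m \<ge> 1"
  obtains L where "set L \<subseteq> stmts M" "concludes M (seq_term M \<rho> k) H \<rho> m (H @ L)"
proof -
  have "admissible M H \<rho> m" "is_rule M (seq_term M \<rho> k)"
    using assms unfolding is_library_def admissible_def by blast+
  then show thesis
    using that unfolding is_rule_def by blast
qed

text \<open>A summand of a sum of naturals is at most the sum. The soundness induction descends
  along this strict decrease.\<close>

lemma runtime_subproc_less:
  assumes "\<alpha> \<in> algos M" "halts M \<alpha> u" "(\<beta>, w) \<in># subprocs M \<alpha> u" "halts M \<beta> w"
  shows "runtime M \<beta> w < runtime M \<alpha> u"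
proof -
  let ?S = "filter_mset (\<lambda>(\<beta>, w). halts M \<beta> w) (subprocs M \<alpha> u)"
  have "(\<beta>, w) \<in># ?S"
    using assms by simp
  then obtain T where "?S = add_mset (\<beta>, w) T"
    by (meson multi_member_split)
  then have "runtime M \<beta> w \<le> (\<Sum>(\<beta>, w) \<in># ?S. runtime M \<beta> w)"
    by simp
  also have "\<dots> < runtime M \<alpha> u"
    by (rule runtime_subprocs[OF assms(1,2)])
  finally show ?thesis .
qed

end

context deduction_framework
begin

section \<open>Truth and direct falsity of compound statements\<close>

lemma imp_in_stmts [simp]: "imp M \<rho> A B \<in> stmts M"
  unfolding imp_def deducible_def using deduce_algo by simp

lemma conj_st_in_stmts [simp]: "conj_st M A B \<in> stmts M"
  unfolding conj_st_def using and_algo by simp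

lemma disj_st_in_stmts [simp]: "disj_st M A B \<in> stmts M"
  unfolding disj_st_def using or_algo by simp

lemma neg_st_in_stmts [simp]: "neg_st M A \<in> stmts M"
  unfolding neg_st_def using sneg_algo by simp

lemma conj_st_true:
  "A \<in> stmts M \<Longrightarrow> B \<in> stmts M \<Longrightarrow>
    conj_st M A B \<in> true_stmts M \<longleftrightarrow> A \<in> true_stmts M \<and> B \<in> true_stmts M"
  unfolding conj_st_def using and_algo by (simp add: stmt_in_true_stmts and_outp)

lemma conj_st_directly_false:
  "A \<in> stmts M \<Longrightarrow> B \<in> stmts M \<Longrightarrow>
    conj_st M A B \<in> directly_false_stmts M \<longleftrightarrow>
      A \<in> directly_false_stmts M \<or> B \<in> directly_false_stmts M"
  unfolding conj_st_def using and_algo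
  by (auto simp: stmt_in_directly_false_stmts and_outp dest: true_not_directly_false)

lemma disj_st_true:
  "A \<in> stmts M \<Longrightarrow> B \<in> stmts M \<Longrightarrow>
    disj_st M A B \<in> true_stmts M \<longleftrightarrow> A \<in> true_stmts M \<or> B \<in> true_stmts M"
  unfolding disj_st_def using or_algo by (simp add: stmt_in_true_stmts or_outp)

lemma disj_st_directly_false:
  "A \<in> stmts M \<Longrightarrow> B \<in> stmts M \<Longrightarrow>
    disj_st M A B \<in> directly_false_stmts M \<longleftrightarrow>
      A \<in> directly_false_stmts M \<and> B \<in> directly_false_stmts M"
  unfolding disj_st_def using or_algo
  by (auto simp: stmt_in_directly_false_stmts or_outp dest: true_not_directly_false)

text \<open>The algorithm \<open>sneg\<close> has to see the process halt, so negation is strong: a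
  statement whose process runs forever is neither true nor directly false, and the same goes for its
  negation.\<close>

lemma neg_st_true:
  assumes "A \<in> stmts M"
  shows "neg_st M A \<in> true_stmts M \<longleftrightarrow> A \<in> directly_false_stmts M"
proof -
  obtain \<alpha> u v where "A = stmt M \<alpha> u v" "\<alpha> \<in> algos M"
    using assms unfolding stmts_def by blast
  then show ?thesis
    unfolding neg_st_def using sneg_algo
    by (auto simp: stmt_in_true_stmts stmt_in_directly_false_stmts sneg_outp split: option.splits)
qed

lemma neg_st_directly_false:
  assumes "A \<in> stmts M"
  shows "neg_st M A \<in> directly_false_stmts M \<longleftrightarrow> A \<in> true_stmts M"
proof -
  obtain \<alpha> u v where "A = stmt M \<alpha> u v" "\<alpha> \<in> algos M"
    using assms unfolding stmts_def by blast
  then show ?thesis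
    unfolding neg_st_def using sneg_algo
    by (auto simp: stmt_in_true_stmts stmt_in_directly_false_stmts sneg_outp split: option.splits)
qed

text \<open>Together these are the strong Kleene truth tables, with non-halting as the third
  value.\<close>

lemmas connectives_true =
  conj_st_true conj_st_directly_false disj_st_true disj_st_directly_false
  neg_st_true neg_st_directly_false

section \<open>The deductive closure of a list of statements\<close>

lemma enum_pairs_pos:
  assumes "i \<ge> 1"
  shows "fst (enum_pairs M i) \<ge> 1" "snd (enum_pairs M i) \<ge> 1"
proof -
  have "enum_pairs M i \<in> {1..} \<times> {1..}"
    using bij_betwE[OF enum_bij] assms by simp
  then show "fst (enum_pairs M i) \<ge> 1" "snd (enum_pairs M i) \<ge> 1"
    by auto
qed

text \<open>Infinitely many pairs have first component \<open>k\<close> and a large second one,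
  while only finitely many pairs occur up to position \<open>i\<close>. Hence some such pair occurs
  later.\<close>

lemma enum_pairs_late:
  assumes "k \<ge> 1"
  obtains j m' where "j \<ge> i" "m' \<ge> m" "enum_pairs M (Suc j) = (k, m')"
proof -
  define S where "S = enum_pairs M ` {1..i}"
  have "infinite (Pair k ` {max 1 m..})"
    by (simp add: finite_image_iff inj_on_def infinite_Ici)
  then obtain p where p: "p \<in> Pair k ` {max 1 m..}" "p \<notin> S"
    unfolding S_def by (meson finite_atLeastAtMost finite_imageI finite_subset subsetI)
  then have "p \<in> {1..} \<times> {1..}"
    using assms by auto
  then obtain n where n: "n \<ge> 1" "enum_pairs M n = p"
    using enum_bij unfolding bij_betw_def by (metis atLeast_iff imageE)
  then have "n > i"
    using p(2) unfolding S_def by (metis atLeastAtMost_iff imageI not_le)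
  then show thesis
    \<comment> \<open>Stage \<open>Suc j\<close> uses the pair at \<open>Suc j\<close>, so position
      \<open>n\<close> corresponds to \<open>j = n - 1\<close>, and \<open>n > i\<close> still gives
      \<open>j \<ge> i\<close>.\<close>
    using that[of "n - 1"] n p(1) by auto
qed

text \<open>The description by \<open>THE\<close> in \<open>ded_list\<close> denotes the actual
  output once the previous list is known to consist of statements, because only then is the rule
  guaranteed to halt with a list. The three facts therefore come from a common step.\<close>

lemma ded_list_concludes:
  assumes "is_library M \<rho>" "set \<Gamma> \<subseteq> stmts M"
  shows "set (ded_list M \<Gamma> \<rho> i) \<subseteq> stmts M"
    and "concludes M (seq_term M \<rho> (fst (enum_pairs M (Suc i)))) (ded_list M \<Gamma> \<rho> i) \<rho>
      (snd (enum_pairs M (Suc i))) (ded_list M \<Gamma> \<rho> (Suc i))" (is "?C i")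
    and "set (ded_list M \<Gamma> \<rho> i) \<subseteq> set (ded_list M \<Gamma> \<rho> (Suc i))"
proof -
  have step: "?C i \<and> set (ded_list M \<Gamma> \<rho> (Suc i)) \<subseteq> stmts M \<and>
      set (ded_list M \<Gamma> \<rho> i) \<subseteq> set (ded_list M \<Gamma> \<rho> (Suc i))"
    if H: "set (ded_list M \<Gamma> \<rho> i) \<subseteq> stmts M" for i
  proof -
    obtain L where L: "set L \<subseteq> stmts M"
      "concludes M (seq_term M \<rho> (fst (enum_pairs M (Suc i)))) (ded_list M \<Gamma> \<rho> i) \<rho>
        (snd (enum_pairs M (Suc i))) (ded_list M \<Gamma> \<rho> i @ L)"
      by (rule library_concludes[OF assms(1) enum_pairs_pos(1)[of "Suc i"] H
          enum_pairs_pos(2)[of "Suc i"]]) auto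
    then have "(THE K. concludes M (seq_term M \<rho> (fst (enum_pairs M (Suc i))))
        (ded_list M \<Gamma> \<rho> i) \<rho> (snd (enum_pairs M (Suc i))) K) = ded_list M \<Gamma> \<rho> i @ L"
      using concludes_unique by blast
    then have "ded_list M \<Gamma> \<rho> (Suc i) = ded_list M \<Gamma> \<rho> i @ L"
      by (simp add: case_prod_beta Let_def)
    with L H show ?thesis
      by (simp del: ded_list.simps)
  qed
  have stmts: "set (ded_list M \<Gamma> \<rho> i) \<subseteq> stmts M" for i
  proof (induction i)
    case 0
    then show ?case using assms(2) by simp
  next
    case (Suc i)
    then show ?case using step by blast
  qed
  show "set (ded_list M \<Gamma> \<rho> i) \<subseteq> stmts M" by (rule stmts)
  show "?C i" "set (ded_list M \<Gamma> \<rho> i) \<subseteq> set (ded_list M \<Gamma> \<rho> (Suc i))"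
    using step[OF stmts] by blast+
qed

text \<open>Forgetting the stages yields the closure of \<Gamma> under the rules of the library
  \<rho>; \<open>derivable_closed\<close> and \<open>derivable_trans\<close> justify this
  reading.\<close>

definition derivable :: "'d list \<Rightarrow> 'd \<Rightarrow> 'd set" where
  "derivable \<Gamma> \<rho> = (\<Union>i. set (ded_list M \<Gamma> \<rho> i))"

lemma derivable_refl: "set \<Gamma> \<subseteq> derivable \<Gamma> \<rho>"
  unfolding derivable_def by (force intro: exI[of _ 0])

lemma derivable_list:
  assumes "is_library M \<rho>" "set \<Gamma> \<subseteq> stmts M" "set H \<subseteq> derivable \<Gamma> \<rho>"
  obtains i where "set H \<subseteq> set (ded_list M \<Gamma> \<rho> i)"
proof -
  have chain: "set (ded_list M \<Gamma> \<rho> i) \<subseteq> set (ded_list M \<Gamma> \<rho> j)" if "i \<le> j" for i j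
    using that ded_list_concludes(3)[OF assms(1,2)] by (rule lift_Suc_mono_le[rotated])
  have "\<exists>i. set H \<subseteq> set (ded_list M \<Gamma> \<rho> i)"
    using assms(3)
  proof (induction H)
    case (Cons A H)
    then obtain i j where "set H \<subseteq> set (ded_list M \<Gamma> \<rho> i)" "A \<in> set (ded_list M \<Gamma> \<rho> j)"
      unfolding derivable_def by auto
    then have "set (A # H) \<subseteq> set (ded_list M \<Gamma> \<rho> (max i j))"
      using chain[of i "max i j"] chain[of j "max i j"] by auto
    then show ?case by blast
  qed simp
  then show thesis using that by blast
qed

text \<open>A finite \<open>H\<close> is contained in some stage, and the rule comes up again at a
  later stage with at least the resource \<open>m\<close>. Monotonicity of the rule in both the list
  and the resource does the rest.\<close>

lemma derivable_closed:
  assumes lib: "is_library M \<rho>" and \<Gamma>: "set \<Gamma> \<subseteq> stmts M"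
    and R: "R \<in> rules_of M \<rho>" and H: "set H \<subseteq> derivable \<Gamma> \<rho>"
    and m: "m \<ge> 1" and K: "concludes M R H \<rho> m K"
  shows "set K \<subseteq> derivable \<Gamma> \<rho>"
proof -
  obtain k where k: "k \<ge> 1" "R = seq_term M \<rho> k"
    using R unfolding rules_of_def by auto
  obtain i where i: "set H \<subseteq> set (ded_list M \<Gamma> \<rho> i)"
    using derivable_list[OF lib \<Gamma> H] .
  obtain j m' where j: "j \<ge> i" "m' \<ge> m" "enum_pairs M (Suc j) = (k, m')"
    using enum_pairs_late[OF k(1)] .
  have Hj: "set H \<subseteq> set (ded_list M \<Gamma> \<rho> j)"
    using i lift_Suc_mono_le[of "\<lambda>i. set (ded_list M \<Gamma> \<rho> i)" i j] j(1)
      ded_list_concludes(3)[OF lib \<Gamma>] by blast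
  have "concludes M R (ded_list M \<Gamma> \<rho> j) \<rho> m' (ded_list M \<Gamma> \<rho> (Suc j))"
    using ded_list_concludes(2)[OF lib \<Gamma>, of j] j(3) k(2) by (simp del: ded_list.simps)
  moreover have "admissible M (ded_list M \<Gamma> \<rho> j) \<rho> m'" "admissible M H \<rho> m"
    using lib Hj ded_list_concludes(1)[OF lib \<Gamma>, of j] m j(2)
    unfolding admissible_def is_library_def by auto
  moreover have "is_rule M R"
    using lib k unfolding is_library_def by blast
  ultimately have "set K \<subseteq> set (ded_list M \<Gamma> \<rho> (Suc j))"
    using K Hj j(2) unfolding is_rule_def by blast
  then show ?thesis
    unfolding derivable_def by blast
qed

lemma derivable_subset_stmts:
  "is_library M \<rho> \<Longrightarrow> set \<Gamma> \<subseteq> stmts M \<Longrightarrow> derivable \<Gamma> \<rho> \<subseteq> stmts M"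
  unfolding derivable_def using ded_list_concludes(1) by blast

lemma derivable_implements:
  assumes "is_library M \<rho>" "set \<Gamma> \<subseteq> stmts M" "R \<in> rules_of M \<rho>" "implements M R Y"
    and "set H \<subseteq> derivable \<Gamma> \<rho>" "m \<ge> 1"
  shows "Y H \<rho> m \<subseteq> derivable \<Gamma> \<rho>"
proof -
  have "admissible M H \<rho> m"
    using assms derivable_subset_stmts[OF assms(1,2)]
    unfolding admissible_def is_library_def by blast
  then obtain L where "set L = Y H \<rho> m" "concludes M R H \<rho> m (H @ L)"
    using assms(4) unfolding implements_def by blast
  then show ?thesis
    using derivable_closed[OF assms(1-3,5,6)] by fastforce
qed

text \<open>This is the cut property: each stage of the deduction from \<Delta> applies a rule of
  \<rho>, under which the closure of \<Gamma> is already closed.\<close>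

lemma derivable_trans:
  assumes lib: "is_library M \<rho>" and \<Gamma>: "set \<Gamma> \<subseteq> stmts M" and \<Delta>: "set \<Delta> \<subseteq> derivable \<Gamma> \<rho>"
  shows "derivable \<Delta> \<rho> \<subseteq> derivable \<Gamma> \<rho>"
proof -
  have \<Delta>_stmts: "set \<Delta> \<subseteq> stmts M"
    using \<Delta> derivable_subset_stmts[OF lib \<Gamma>] by blast
  have "set (ded_list M \<Delta> \<rho> i) \<subseteq> derivable \<Gamma> \<rho>" for i
  proof (induction i)
    case 0
    then show ?case using \<Delta> by simp
  next
    case (Suc i)
    have "seq_term M \<rho> (fst (enum_pairs M (Suc i))) \<in> rules_of M \<rho>"
      unfolding rules_of_def using enum_pairs_pos[of "Suc i"] by simp
    then show ?case
      using derivable_closed[OF lib \<Gamma> _ Suc _ ded_list_concludes(2)[OF lib \<Delta>_stmts]]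
        enum_pairs_pos[of "Suc i"] by simp
  qed
  then show ?thesis
    unfolding derivable_def by blast
qed

section \<open>Truth of implications as membership in the closure\<close>

lemma halts_deduce_iff:
  assumes "is_library M \<rho>" "set \<Gamma> \<subseteq> stmts M" "B \<in> stmts M"
  shows "halts M (deduce_alg M) (ded_input M \<Gamma> \<rho> B) \<longleftrightarrow> B \<in> derivable \<Gamma> \<rho>"
  unfolding halts_def derivable_def using deduce_outp[OF assms(2,1,3)] by simp

lemma imp_true:
  assumes "is_library M \<rho>" "A \<in> stmts M" "B \<in> stmts M"
  shows "imp M \<rho> A B \<in> true_stmts M \<longleftrightarrow> B \<in> derivable [A] \<rho>"
  unfolding imp_def deducible_def derivable_def
  using deduce_outp[of "[A]" \<rho> B] assms deduce_algo by (simp add: stmt_in_true_stmts)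

text \<open>The Universal Rule has no premises, so applying it to the empty list with a large enough
  resource produces any given true statement inside any deduction.\<close>

lemma derivable_true_stmts:
  assumes "is_library M \<rho>" "set \<Gamma> \<subseteq> stmts M" "universal_rule M R" "R \<in> rules_of M \<rho>"
  shows "true_stmts M \<subseteq> derivable \<Gamma> \<rho>"
proof
  fix B
  assume "B \<in> true_stmts M"
  then obtain m where m: "m \<ge> 1" "B \<in> m_true_stmts M m"
    by (rule true_stmt_m_true)
  then show "B \<in> derivable \<Gamma> \<rho>"
    using derivable_implements[OF assms(1,2,4) assms(3)[unfolded universal_rule_def], of "[]" m]
    by auto
qed

lemma derivable_conj_st:
  assumes lib: "is_library M \<rho>" and \<Gamma>: "set \<Gamma> \<subseteq> stmts M"
    and R: "conjunction_rule M R" "R \<in> rules_of M \<rho>"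
    and BC: "B \<in> stmts M" "C \<in> stmts M"
  shows "conj_st M B C \<in> derivable \<Gamma> \<rho> \<longleftrightarrow> B \<in> derivable \<Gamma> \<rho> \<and> C \<in> derivable \<Gamma> \<rho>"
proof (intro iffI)
  note closed = derivable_implements[OF lib \<Gamma> R(2) R(1)[unfolded conjunction_rule_def]]
  show "B \<in> derivable \<Gamma> \<rho> \<and> C \<in> derivable \<Gamma> \<rho>" if "conj_st M B C \<in> derivable \<Gamma> \<rho>"
    using that BC by (intro conjI subsetD[OF closed[of "[conj_st M B C]" 1]]) auto
  show "conj_st M B C \<in> derivable \<Gamma> \<rho>" if "B \<in> derivable \<Gamma> \<rho> \<and> C \<in> derivable \<Gamma> \<rho>"
    using that BC by (intro subsetD[OF closed[of "[B, C]" 1]]) auto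
qed

section \<open>Rules whose validity follows from truth tables or from closure\<close>

lemma universal_rule_valid:
  assumes "universal_rule M R" "is_library M \<rho>"
  shows "rule_valid M \<rho> R"
  using assms m_true_stmts_subset unfolding universal_rule_def is_library_def
  by (blast intro: implements_rule_valid)

lemma conjunction_rule_valid:
  assumes "conjunction_rule M R" "is_library M \<rho>"
  shows "rule_valid M \<rho> R"
proof (rule implements_rule_valid[OF assms(1)[unfolded conjunction_rule_def]])
  show "algorithmic_sequence M \<rho>" using assms(2) unfolding is_library_def by blast
qed (intro Un_least; clarify; (drule (1) rev_subsetD)+; simp add: connectives_true)

lemma disjunction_introduction_rule_valid:
  assumes "disjunction_introduction_rule M R" "is_library M \<rho>"
  shows "rule_valid M \<rho> R"
proof (rule implements_rule_valid[OF assms(1)[unfolded disjunction_introduction_rule_def]])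
  show "algorithmic_sequence M \<rho>" using assms(2) unfolding is_library_def by blast
qed (intro Un_least; clarify; (drule (1) rev_subsetD)+; simp add: connectives_true)

text \<open>Truth of the negation makes the first disjunct directly false, which excludes it as the
  true one.\<close>

lemma elimination_of_case_rule_valid:
  assumes "elimination_of_case_rule M R" "is_library M \<rho>"
  shows "rule_valid M \<rho> R"
proof (rule implements_rule_valid[OF assms(1)[unfolded elimination_of_case_rule_def]])
  show "algorithmic_sequence M \<rho>" using assms(2) unfolding is_library_def by blast
qed (clarify; (drule (1) rev_subsetD)+; auto simp: connectives_true dest: true_not_directly_false)

lemma double_negation_rule_valid:
  assumes "double_negation_rule M R" "is_library M \<rho>"
  shows "rule_valid M \<rho> R"
proof (rule implements_rule_valid[OF assms(1)[unfolded double_negation_rule_def]])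
  show "algorithmic_sequence M \<rho>" using assms(2) unfolding is_library_def by blast
qed (intro Un_least; clarify; (drule (1) rev_subsetD)+; simp add: connectives_true)

text \<open>Negation exchanges truth and direct falsity, and the tables for conjunction and
  disjunction are dual under this exchange, so the laws survive the third value.\<close>

lemma strong_de_morgan_rule_valid:
  assumes "strong_de_morgan_rule M R" "is_library M \<rho>"
  shows "rule_valid M \<rho> R"
proof (rule implements_rule_valid[OF assms(1)[unfolded strong_de_morgan_rule_def]])
  show "algorithmic_sequence M \<rho>" using assms(2) unfolding is_library_def by blast
qed (intro Un_least; clarify; (drule (1) rev_subsetD)+; simp add: connectives_true)

text \<open>Truth of an implication is membership in a closure, so chaining two of them is the cut
  property \<open>derivable_trans\<close>.\<close>

lemma transitivity_rule_valid:
  assumes "transitivity_rule M R" "is_library M \<rho>"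
  shows "rule_valid M \<rho> R"
proof (rule implements_rule_valid[OF assms(1)[unfolded transitivity_rule_def]])
  show "algorithmic_sequence M \<rho>" using assms(2) unfolding is_library_def by blast
  have "imp M \<rho> A C \<in> true_stmts M"
    if "A \<in> stmts M" "B \<in> stmts M" "C \<in> stmts M"
      "imp M \<rho> A B \<in> true_stmts M" "imp M \<rho> B C \<in> true_stmts M" for A B C
    using that derivable_trans[OF assms(2), of "[A]" "[B]"] by (auto simp: imp_true[OF assms(2)])
  then show "{imp M \<rho> A C |A B C. A \<in> stmts M \<and> B \<in> stmts M \<and> C \<in> stmts M \<and>
      imp M \<rho> A B \<in> set H \<and> imp M \<rho> B C \<in> set H} \<subseteq> true_stmts M"
    if "set H \<subseteq> true_stmts M" for H
    using that by blast
qed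

lemma meta_universal_rule_valid:
  assumes "meta_universal_rule M R" "is_library M \<rho>"
    and "universal_rule M R_univ" "R_univ \<in> rules_of M \<rho>"
  shows "rule_valid M \<rho> R"
proof (rule implements_rule_valid[OF assms(1)[unfolded meta_universal_rule_def]])
  show "algorithmic_sequence M \<rho>" using assms(2) unfolding is_library_def by blast
  have "imp M \<rho> A B \<in> true_stmts M"
    if "A \<in> stmts M" "B \<in> stmts M" "B \<in> true_stmts M" for A B
    using that derivable_true_stmts[OF assms(2) _ assms(3,4), of "[A]"]
    by (auto simp: imp_true[OF assms(2)])
  then show "{imp M \<rho> A B |A B. A \<in> stmts M \<and> B \<in> stmts M \<and> B \<in> set H \<and>
      dsize M (imp M \<rho> A B) \<le> m} \<subseteq> true_stmts M"
    if "set H \<subseteq> true_stmts M" for H m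
    using that by blast
qed

lemma meta_conjunction_rule_valid:
  assumes "meta_conjunction_rule M R" "is_library M \<rho>"
    and "conjunction_rule M R_conj" "R_conj \<in> rules_of M \<rho>"
  shows "rule_valid M \<rho> R"
proof (rule implements_rule_valid[OF assms(1)[unfolded meta_conjunction_rule_def]])
  show "algorithmic_sequence M \<rho>" using assms(2) unfolding is_library_def by blast
  have "imp M \<rho> A (conj_st M B C) \<in> true_stmts M"
    if "A \<in> stmts M" "B \<in> stmts M" "C \<in> stmts M"
      "imp M \<rho> A B \<in> true_stmts M" "imp M \<rho> A C \<in> true_stmts M" for A B C
    using that by (simp add: imp_true[OF assms(2)] derivable_conj_st[OF assms(2) _ assms(3,4)])
  then show "{imp M \<rho> A (conj_st M B C) |A B C. A \<in> stmts M \<and> B \<in> stmts M \<and> C \<in> stmts M \<and>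
      imp M \<rho> A B \<in> set H \<and> imp M \<rho> A C \<in> set H} \<subseteq> true_stmts M"
    if "set H \<subseteq> true_stmts M" for H
    using that by blast
qed

section \<open>Meta-Disjunction and soundness of deduction\<close>

text \<open>The two implications are true, so the Universal Rule derives them inside the deduction
  from the conjunction. The Conjunction Rule splits off \<open>G\<close> and the disjunction, and
  Disjunction Elimination then has all four premises. Only membership of these rules in the library
  is used, not their validity.\<close>

lemma imp_conj_disj_true:
  assumes lib: "is_library M \<rho>"
    and univ: "universal_rule M R_univ" "R_univ \<in> rules_of M \<rho>"
    and conj: "conjunction_rule M R_conj" "R_conj \<in> rules_of M \<rho>"
    and elim: "disjunction_elimination_rule M R_elim" "R_elim \<in> rules_of M \<rho>"
    and stmts: "G \<in> stmts M" "A \<in> stmts M" "B \<in> stmts M" "C \<in> stmts M"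
    and prem: "imp M \<rho> (conj_st M G A) C \<in> true_stmts M"
      "imp M \<rho> (conj_st M G B) C \<in> true_stmts M"
  shows "imp M \<rho> (conj_st M G (disj_st M A B)) C \<in> true_stmts M"
proof -
  let ?P = "conj_st M G (disj_st M A B)"
  let ?H = "[imp M \<rho> (conj_st M G A) C, imp M \<rho> (conj_st M G B) C, G, disj_st M A B]"
  let ?t = "\<lambda>D. runtime M (deduce_alg M) (ded_input M [conj_st M G D] \<rho> C)"
  \<comment> \<open>The resource must strictly exceed both runtimes for the rule to accept the two
    implications; \<open>Suc\<close> gives the strictness.\<close>
  define m where "m = Suc (?t A + ?t B)"
  have "G \<in> derivable [?P] \<rho>" "disj_st M A B \<in> derivable [?P] \<rho>"
    using derivable_refl[of "[?P]" \<rho>] stmts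
      derivable_conj_st[OF lib _ conj stmts(1), of "[?P]" "disj_st M A B"]
    by simp_all
  then have "set ?H \<subseteq> derivable [?P] \<rho>"
    using derivable_true_stmts[OF lib _ univ, of "[?P]"] prem by auto
  moreover have "disj_elim_match M ?H \<rho> G A B C"
    unfolding disj_elim_match_def using stmts by simp
  moreover have "imp_halts_below M \<rho> (conj_st M G A) C m" "imp_halts_below M \<rho> (conj_st M G B) C m"
    using prem stmts unfolding imp_halts_below_def m_def
    by (auto simp: imp_true[OF lib] halts_deduce_iff[OF lib])
  moreover have "m \<ge> 1" unfolding m_def by simp
  ultimately have "C \<in> derivable [?P] \<rho>"
    using prem
    by (intro subsetD[OF derivable_implements[OF lib _ elim(2)
          elim(1)[unfolded disjunction_elimination_rule_def, THEN conjunct1], of "[?P]" ?H m]]) auto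
  then show ?thesis
    using stmts by (simp add: imp_true[OF lib])
qed

lemma meta_disjunction_rule_valid:
  assumes "meta_disjunction_rule M R" "is_library M \<rho>"
    and "universal_rule M R_univ" "R_univ \<in> rules_of M \<rho>"
    and "conjunction_rule M R_conj" "R_conj \<in> rules_of M \<rho>"
    and "disjunction_elimination_rule M R_elim" "R_elim \<in> rules_of M \<rho>"
  shows "rule_valid M \<rho> R"
proof (rule implements_rule_valid[OF assms(1)[unfolded meta_disjunction_rule_def]])
  show "algorithmic_sequence M \<rho>" using assms(2) unfolding is_library_def by blast
  show "{imp M \<rho> (conj_st M G (disj_st M A B)) C |G A B C.
      G \<in> stmts M \<and> A \<in> stmts M \<and> B \<in> stmts M \<and> C \<in> stmts M \<and>
      imp M \<rho> (conj_st M G A) C \<in> set H \<and> imp M \<rho> (conj_st M G B) C \<in> set H} \<subseteq> true_stmts M"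
    if "set H \<subseteq> true_stmts M" for H
    using that imp_conj_disj_true[OF assms(2-8)] by blast
qed

text \<open>
  The hypothesis on \<open>sound\<close> is the induction hypothesis in the soundness proof for \<open>deduce\<close>, where
  the bound is the runtime of the rule.
\<close>

lemma disjunction_elimination_step:
  assumes R: "disjunction_elimination_rule M R" and lib: "is_library M \<rho>"
    and H: "set H \<subseteq> true_stmts M" and m: "m \<ge> 1" and K: "concludes M R H \<rho> m K"
    and sound: "\<And>A C. A \<in> true_stmts M \<Longrightarrow> C \<in> stmts M \<Longrightarrow>
      halts M (deduce_alg M) (ded_input M [A] \<rho> C) \<Longrightarrow>
      runtime M (deduce_alg M) (ded_input M [A] \<rho> C) < runtime M R (rule_input M H \<rho> m) \<Longrightarrow>
      C \<in> true_stmts M"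
  shows "set K \<subseteq> true_stmts M"
proof
  fix C
  assume "C \<in> set K"
  have adm: "admissible M H \<rho> m"
    using H lib m true_stmts_subset unfolding admissible_def is_library_def by blast
  have impl: "implements M R (\<lambda>H \<rho> m.
      {C | G A B C. disj_elim_match M H \<rho> G A B C \<and>
         imp_halts_below M \<rho> (conj_st M G A) C m \<and> imp_halts_below M \<rho> (conj_st M G B) C m \<and>
         imp M \<rho> (conj_st M G A) C \<in> true_stmts M \<and>
         imp M \<rho> (conj_st M G B) C \<in> true_stmts M})"
    using R unfolding disjunction_elimination_rule_def by blast
  have "C \<in> true_stmts M"
    if match: "disj_elim_match M H \<rho> G A B C"
      and below: "imp_halts_below M \<rho> (conj_st M G A) C m" "imp_halts_below M \<rho> (conj_st M G B) C m"
    for G A B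
  proof -
    have stmts: "G \<in> stmts M" "A \<in> stmts M" "B \<in> stmts M" "C \<in> stmts M"
      and true: "G \<in> true_stmts M" "disj_st M A B \<in> true_stmts M"
      using match H unfolding disj_elim_match_def by blast+
    \<comment> \<open>The deduction that starts from the true disjunct starts from a true
      conjunction, so soundness is applied to that one alone.\<close>
    then obtain D where D: "D \<in> {A, B}" "D \<in> true_stmts M"
      by (auto simp: disj_st_true)
    have "conj_st M G D \<in> true_stmts M"
      using D stmts true by (auto simp: conj_st_true)
    moreover have D_below: "imp_halts_below M \<rho> (conj_st M G D) C m"
      using D(1) below by blast
    then have D_halts: "halts M (deduce_alg M) (ded_input M [conj_st M G D] \<rho> C)"
      unfolding imp_halts_below_def by blast
    moreover have "(deduce_alg M, ded_input M [conj_st M G D] \<rho> C)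
        \<in># subprocs M R (rule_input M H \<rho> m)"
      using R adm match D(1) D_below unfolding disjunction_elimination_rule_def by blast
    moreover have "R \<in> algos M" "halts M R (rule_input M H \<rho> m)"
      using impl K unfolding implements_def concludes_def halts_def by auto
    ultimately show ?thesis
      using sound runtime_subproc_less stmts(4) by blast
  qed
  then show "C \<in> true_stmts M"
    using \<open>C \<in> set K\<close> H unfolding implements_set[OF impl adm K] by blast
qed

text \<open>Outer induction on the runtime of the deduction, inner induction on its stages. Rules
  other than \<open>R\<close> preserve truth by \<open>valid\<close>. A use of \<open>R\<close> is a
  subprocess of the deduction, and the deductions that \<open>R\<close> trusts are subprocesses of
  that use, so the outer hypothesis covers them. \<Gamma> and \<open>B\<close> are arbitrary because
  those deductions have their own premises and conclusions.\<close>

lemma deduce_sound: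
  assumes lib: "is_library M \<rho>" and R: "disjunction_elimination_rule M R"
    and valid: "\<And>S. S \<in> rules_of M \<rho> \<Longrightarrow> S \<noteq> R \<Longrightarrow> rule_valid M \<rho> S"
    and "set \<Gamma> \<subseteq> true_stmts M" "B \<in> stmts M"
    and "halts M (deduce_alg M) (ded_input M \<Gamma> \<rho> B)"
  shows "B \<in> true_stmts M"
  using assms(4-)
proof (induction "runtime M (deduce_alg M) (ded_input M \<Gamma> \<rho> B)" arbitrary: \<Gamma> B rule: less_induct)
  case less
  have \<Gamma>: "set \<Gamma> \<subseteq> stmts M"
    using less.prems(1) true_stmts_subset by blast
  have ex: "\<exists>i. B \<in> set (ded_list M \<Gamma> \<rho> i)"
    using less.prems halts_deduce_iff[OF lib \<Gamma>] unfolding derivable_def by blast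
  define n where "n = (LEAST i. B \<in> set (ded_list M \<Gamma> \<rho> i))"
  \<comment> \<open>The stages are followed only up to the first occurrence of \<open>B\<close>,
    which is as far as \<open>deduce_subprocs\<close> guarantees that they are run.\<close>
  have "set (ded_list M \<Gamma> \<rho> i) \<subseteq> true_stmts M" if "i \<le> n" for i
    using that
  proof (induction i)
    case 0
    then show ?case using less.prems(1) by simp
  next
    case (Suc i)
    define S where "S = seq_term M \<rho> (fst (enum_pairs M (Suc i)))"
    define m where "m = snd (enum_pairs M (Suc i))"
    have K: "concludes M S (ded_list M \<Gamma> \<rho> i) \<rho> m (ded_list M \<Gamma> \<rho> (Suc i))"
      unfolding S_def m_def by (rule ded_list_concludes(2)[OF lib \<Gamma>])
    have m: "m \<ge> 1" and S: "S \<in> rules_of M \<rho>"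
      unfolding m_def S_def rules_of_def using enum_pairs_pos[of "Suc i"] by auto
    have H: "set (ded_list M \<Gamma> \<rho> i) \<subseteq> true_stmts M"
      using Suc by simp
    show ?case
    proof (cases "S = R")
      case False
      then show ?thesis
        using valid[OF S] H K m unfolding rule_valid_def by blast
    next
      case True
      have "ded_step M \<Gamma> \<rho> (Suc i) \<in># image_mset (ded_step M \<Gamma> \<rho>) (mset_set {1..n})"
        using Suc.prems by simp
      then have "ded_step M \<Gamma> \<rho> (Suc i) \<in># subprocs M (deduce_alg M) (ded_input M \<Gamma> \<rho> B)"
        unfolding n_def by (rule mset_subset_eqD[OF deduce_subprocs[OF \<Gamma> lib less.prems(2) ex]])
      moreover have "ded_step M \<Gamma> \<rho> (Suc i) = (S, rule_input M (ded_list M \<Gamma> \<rho> i) \<rho> m)"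
        unfolding ded_step_def S_def m_def by (simp add: case_prod_beta Let_def)
      ultimately have "(S, rule_input M (ded_list M \<Gamma> \<rho> i) \<rho> m)
          \<in># subprocs M (deduce_alg M) (ded_input M \<Gamma> \<rho> B)"
        by simp
      then have "runtime M S (rule_input M (ded_list M \<Gamma> \<rho> i) \<rho> m)
          < runtime M (deduce_alg M) (ded_input M \<Gamma> \<rho> B)"
        using K runtime_subproc_less[OF deduce_algo less.prems(3)]
        unfolding concludes_def halts_def by simp
      then have "C \<in> true_stmts M"
        if "A \<in> true_stmts M" "C \<in> stmts M"
          "halts M (deduce_alg M) (ded_input M [A] \<rho> C)"
          "runtime M (deduce_alg M) (ded_input M [A] \<rho> C)
            < runtime M R (rule_input M (ded_list M \<Gamma> \<rho> i) \<rho> m)" for A C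
        \<comment> \<open>Two strict decreases combine: from the current deduction to the use of
          \<open>R\<close>, and from there to the nested deduction.\<close>
        using that True by (intro less.hyps[of "[A]" C]) simp_all
      then show ?thesis
        using disjunction_elimination_step[OF R lib H m K[unfolded True]] by blast
    qed
  qed
  moreover have "B \<in> set (ded_list M \<Gamma> \<rho> n)"
    unfolding n_def by (rule LeastI_ex[OF ex])
  ultimately show ?case by blast
qed

text \<open>Soundness now holds for deductions of every runtime, so the analysis of a single
  application covers every list of true hypotheses.\<close>

lemma disjunction_elimination_rule_valid:
  assumes "disjunction_elimination_rule M R" "is_library M \<rho>"
    and "\<And>S. S \<in> rules_of M \<rho> \<Longrightarrow> S \<noteq> R \<Longrightarrow> rule_valid M \<rho> S"
  shows "rule_valid M \<rho> R"
  unfolding rule_valid_def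
proof (intro allI impI)
  fix H m K
  assume a: "set H \<subseteq> true_stmts M \<and> 1 \<le> m \<and> concludes M R H \<rho> m K"
  have "C \<in> true_stmts M"
    if "A \<in> true_stmts M" "C \<in> stmts M"
      "halts M (deduce_alg M) (ded_input M [A] \<rho> C)" for A C
    using that by (intro deduce_sound[OF assms(2,1,3), of "[A]" C]) simp_all
  then show "set K \<subseteq> true_stmts M"
    using disjunction_elimination_step[OF assms(1,2), of H m K] a by blast
qed

section \<open>The algorithms of the base are rules\<close>

lemma disjunction_elimination_rule_is_rule:
  assumes "disjunction_elimination_rule M R"
  shows "is_rule M R"
proof (rule implements_is_rule)
  show "implements M R (\<lambda>H \<rho> m.
      {C | G A B C. disj_elim_match M H \<rho> G A B C \<and>
         imp_halts_below M \<rho> (conj_st M G A) C m \<and> imp_halts_below M \<rho> (conj_st M G B) C m \<and>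
         imp M \<rho> (conj_st M G A) C \<in> true_stmts M \<and>
         imp M \<rho> (conj_st M G B) C \<in> true_stmts M})"
    using assms unfolding disjunction_elimination_rule_def by blast
  show "{C | G A B C. disj_elim_match M H \<rho> G A B C \<and>
      imp_halts_below M \<rho> (conj_st M G A) C m \<and> imp_halts_below M \<rho> (conj_st M G B) C m \<and>
      imp M \<rho> (conj_st M G A) C \<in> true_stmts M \<and>
      imp M \<rho> (conj_st M G B) C \<in> true_stmts M} \<subseteq>
    {C | G A B C. disj_elim_match M H' \<rho> G A B C \<and>
      imp_halts_below M \<rho> (conj_st M G A) C m' \<and> imp_halts_below M \<rho> (conj_st M G B) C m' \<and>
      imp M \<rho> (conj_st M G A) C \<in> true_stmts M \<and>
      imp M \<rho> (conj_st M G B) C \<in> true_stmts M}"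
    if "set H \<subseteq> set H'" "m \<le> m'" for H H' \<rho> m m'
    \<comment> \<open>Enlarging the resource only weakens the test \<open>runtime < m\<close>; the
      truth conditions do not depend on the list or the resource.\<close>
    using that less_le_trans[OF _ that(2)]
    unfolding disj_elim_match_def imp_halts_below_def by blast
qed (auto simp: disj_elim_match_def)

lemma diagram_rules_are_rules:
  "transitivity_rule M R \<Longrightarrow> is_rule M R"
  "universal_rule M R \<Longrightarrow> is_rule M R"
  "meta_universal_rule M R \<Longrightarrow> is_rule M R"
  "conjunction_rule M R \<Longrightarrow> is_rule M R"
  "meta_conjunction_rule M R \<Longrightarrow> is_rule M R"
  "disjunction_introduction_rule M R \<Longrightarrow> is_rule M R"
  "meta_disjunction_rule M R \<Longrightarrow> is_rule M R"
  "elimination_of_case_rule M R \<Longrightarrow> is_rule M R"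
  "double_negation_rule M R \<Longrightarrow> is_rule M R"
  "strong_de_morgan_rule M R \<Longrightarrow> is_rule M R"
  unfolding transitivity_rule_def universal_rule_def meta_universal_rule_def conjunction_rule_def
    meta_conjunction_rule_def disjunction_introduction_rule_def meta_disjunction_rule_def
    elimination_of_case_rule_def double_negation_rule_def strong_de_morgan_rule_def
  by (erule implements_is_rule; (auto simp: m_true_stmts_def; fail | blast intro: le_trans))+

end

section \<open>Stability of the base\<close>

theorem theorem13p2:
  fixes M :: "'d deduction_model"
  assumes "deduction_framework M"
    and "transitivity_rule M R_trans"
    and "universal_rule M R_univ"
    and "meta_universal_rule M R_meta_univ"
    and "conjunction_rule M R_conj"
    and "meta_conjunction_rule M R_meta_conj"
    and "disjunction_introduction_rule M R_disj_intro"
    and "disjunction_elimination_rule M R_disj_elim"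
    and "meta_disjunction_rule M R_meta_disj"
    and "elimination_of_case_rule M R_elim_case"
    and "double_negation_rule M R_dneg"
    and "strong_de_morgan_rule M R_de_morgan"
  shows "is_stable_base M {R_trans, R_univ, R_meta_univ, R_conj, R_meta_conj, R_disj_intro,
    R_disj_elim, R_meta_disj, R_elim_case, R_dneg, R_de_morgan}"
proof -
  interpret deduction_framework M by (rule assms(1))
  let ?\<B> = "{R_trans, R_univ, R_meta_univ, R_conj, R_meta_conj, R_disj_intro,
    R_disj_elim, R_meta_disj, R_elim_case, R_dneg, R_de_morgan}"
  have "library_valid M \<rho>" if base: "base_library M ?\<B> \<rho>" and outside: "valid_outside M ?\<B> \<rho>" for \<rho>
  proof -
    have lib: "is_library M \<rho>" and mem: "R_univ \<in> rules_of M \<rho>" "R_conj \<in> rules_of M \<rho>"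
        "R_disj_elim \<in> rules_of M \<rho>"
      using base unfolding base_library_def by auto
    \<comment> \<open>There is no circularity: the meta rules use Disjunction Elimination and the
      other rules only as members of the library. All rules but this one are therefore settled
      before soundness of deduction is invoked.\<close>
    have valid: "rule_valid M \<rho> S" if "S \<in> rules_of M \<rho>" "S \<noteq> R_disj_elim" for S
    proof (cases "S \<in> ?\<B>")
      case False
      then show ?thesis
        using outside that(1) unfolding valid_outside_def by blast
    next
      case True
      with that(2) show ?thesis
        using transitivity_rule_valid[OF assms(2) lib] universal_rule_valid[OF assms(3) lib]
          meta_universal_rule_valid[OF assms(4) lib assms(3) mem(1)]
          conjunction_rule_valid[OF assms(5) lib]
          meta_conjunction_rule_valid[OF assms(6) lib assms(5) mem(2)]
          disjunction_introduction_rule_valid[OF assms(7) lib]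
          meta_disjunction_rule_valid[OF assms(9) lib assms(3) mem(1) assms(5) mem(2) assms(8) mem(3)]
          elimination_of_case_rule_valid[OF assms(10) lib]
          double_negation_rule_valid[OF assms(11) lib]
          strong_de_morgan_rule_valid[OF assms(12) lib]
        by blast
    qed
    then show ?thesis
      using disjunction_elimination_rule_valid[OF assms(8) lib valid]
      unfolding library_valid_def by metis
  qed
  moreover have "is_base M ?\<B>"
    unfolding is_base_def
    using assms(2-12) diagram_rules_are_rules disjunction_elimination_rule_is_rule by auto
  ultimately show ?thesis
    unfolding is_stable_base_def by blast
qed

end
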